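(* Consider the optimal control problem $(P)$ described in the context with $N_0>0$, $D_0=0$, $0<S_0\le S_{max}$. Put $$t_S=\frac1\alpha\ln\frac{\alpha S_0+w_{max}}{w_{max}}$$ and assume $t_S<T$. Then the control $$u^*(t)=\begin{cases}0,& t\in[0,t_S)\\ w_{max},& t\in[t_S,T]\end{cases},\qquad v^*(t)=\begin{cases}0,& t\in[0,t_S)\\ A w_{max},& t\in[t_S,T]\end{cases},\qquad w^*(t)\equiv w_{max}$$ is optimal in $(P)$. The moment $t_S$ is the moment at which the stock becomes empty, i.e. the corresponding trajectory satisfies $S(t)>0$ on $[0,t_S)$ and $S(t_S)=0$. The optimal value is $$\mathcal J(u^*,v^*,w^* )=N_0+(p w_{max}-B)T+(A+K)w_{max}(t_S-T).$$
   Context: Problem $(P)$: given constants $T,p,r,A,K,B,\alpha,u_{max},v_{max},w_{max},S_{max}>0$ and initial values $N_0,D_0,S_0$, maximize $$\mathcal J(u,v,w)=N(T)-D(T)$$ over piecewise continuous controls $(u,v,w)$ on $[0,T]$ with $0\le u(t)\le u_{max}$, $0\le v(t)\le v_{max}$, $0\le w(t)\le w_{max}$, subject to $$\dot N=p w-v-Ku-B,\ N(0)=N_0;\qquad \dot D=rD+Au-v,\ D(0)=D_0;\qquad \dot S=u-w-\alpha S,\ S(0)=S_0,$$ and to the state constraints $N(t)\ge0$, $D(t)\ge0$, $0\le S(t)\le S_{max}$ for all $t\in[0,T]$. A control is optimal if it is admissible (satisfies all the constraints) and attains the maximum of $\mathcal J$ over all admissible controls. Standing assumptions: $w_{max}\le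 u_{max}$; $v_{max}\ge A w_{max}$ (the maximal repayment rate is large); and the firm is profitable, i.e. $p w>Ku+B+Au$ along the strategy considered, which for $u=w=w_{max}$ reads $(p-A-K)w_{max}>B$. *)

theory Defs
  imports "HOL-Analysis.Analysis"
begin

definition piecewise_continuous_on :: "real \<Rightarrow> real \<Rightarrow> (real \<Rightarrow> real) \<Rightarrow> bool" where
  "piecewise_continuous_on a b f \<longleftrightarrow>
     (\<exists>F. finite F \<and> continuous_on ({a..b} - F) f) \<and>
     (\<forall>t\<in>{a..<b}. \<exists>l. (f \<longlongrightarrow> l) (at_right t)) \<and>
     (\<forall>t\<in>{a<..b}. \<exists>l. (f \<longlongrightarrow> l) (at_left t))"

text \<open>
  The states are continuous and satisfy the differential equations outside a finite set,
  since the controls may jump at finitely many times.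
\<close>

definition trajectory ::
  "real \<Rightarrow> real \<Rightarrow> real \<Rightarrow> real \<Rightarrow> real \<Rightarrow> real \<Rightarrow> real \<Rightarrow> real \<Rightarrow> real \<Rightarrow> real \<Rightarrow>
   (real \<Rightarrow> real) \<Rightarrow> (real \<Rightarrow> real) \<Rightarrow> (real \<Rightarrow> real) \<Rightarrow>
   (real \<Rightarrow> real) \<Rightarrow> (real \<Rightarrow> real) \<Rightarrow> (real \<Rightarrow> real) \<Rightarrow> bool" where
  "trajectory T p r A K B \<alpha> N0 D0 S0 u v w N D S \<longleftrightarrow>
     continuous_on {0..T} N \<and> continuous_on {0..T} D \<and> continuous_on {0..T} S \<and>
     N 0 = N0 \<and> D 0 = D0 \<and> S 0 = S0 \<and>
     (\<exists>F. finite F \<and> (\<forall>t\<in>{0..T} - F.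
        (N has_real_derivative (p * w t - v t - K * u t - B)) (at t within {0..T}) \<and>
        (D has_real_derivative (r * D t + A * u t - v t)) (at t within {0..T}) \<and>
        (S has_real_derivative (u t - w t - \<alpha> * S t)) (at t within {0..T})))"

definition admissible_control ::
  "real \<Rightarrow> real \<Rightarrow> real \<Rightarrow> real \<Rightarrow> real \<Rightarrow> real \<Rightarrow> real \<Rightarrow> real \<Rightarrow> real \<Rightarrow> real \<Rightarrow> real \<Rightarrow>
   real \<Rightarrow> real \<Rightarrow> real \<Rightarrow>
   (real \<Rightarrow> real) \<Rightarrow> (real \<Rightarrow> real) \<Rightarrow> (real \<Rightarrow> real) \<Rightarrow> bool" where
  "admissible_control T p r A K B \<alpha> umax vmax wmax Smax N0 D0 S0 u v w \<longleftrightarrow>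
     piecewise_continuous_on 0 T u \<and> piecewise_continuous_on 0 T v \<and>
     piecewise_continuous_on 0 T w \<and>
     (\<forall>t\<in>{0..T}. 0 \<le> u t \<and> u t \<le> umax \<and> 0 \<le> v t \<and> v t \<le> vmax \<and> 0 \<le> w t \<and> w t \<le> wmax) \<and>
     (\<exists>N D S. trajectory T p r A K B \<alpha> N0 D0 S0 u v w N D S \<and>
        (\<forall>t\<in>{0..T}. 0 \<le> N t \<and> 0 \<le> D t \<and> 0 \<le> S t \<and> S t \<le> Smax))"

text \<open>
  The functional \<open>\<J>(u,v,w) = N(T) - D(T)\<close>; the description is proper because the
  trajectory of a control is unique on \<open>[0,T]\<close> (see \<open>trajectory_unique\<close> and
  \<open>payoff_eq\<close> below).
\<close>

definition payoff ::
  "real \<Rightarrow> real \<Rightarrow> real \<Rightarrow> real \<Rightarrow> real \<Rightarrow> real \<Rightarrow> real \<Rightarrow> real \<Rightarrow> real \<Rightarrow> real \<Rightarrow>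
   (real \<Rightarrow> real) \<Rightarrow> (real \<Rightarrow> real) \<Rightarrow> (real \<Rightarrow> real) \<Rightarrow> real" where
  "payoff T p r A K B \<alpha> N0 D0 S0 u v w =
     (THE J. \<exists>N D S. trajectory T p r A K B \<alpha> N0 D0 S0 u v w N D S \<and> J = N T - D T)"

definition optimal_control ::
  "real \<Rightarrow> real \<Rightarrow> real \<Rightarrow> real \<Rightarrow> real \<Rightarrow> real \<Rightarrow> real \<Rightarrow> real \<Rightarrow> real \<Rightarrow> real \<Rightarrow> real \<Rightarrow>
   real \<Rightarrow> real \<Rightarrow> real \<Rightarrow>
   (real \<Rightarrow> real) \<Rightarrow> (real \<Rightarrow> real) \<Rightarrow> (real \<Rightarrow> real) \<Rightarrow> bool" where
  "optimal_control T p r A K B \<alpha> umax vmax wmax Smax N0 D0 S0 u v w \<longleftrightarrow>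
     admissible_control T p r A K B \<alpha> umax vmax wmax Smax N0 D0 S0 u v w \<and>
     (\<forall>u' v' w'. admissible_control T p r A K B \<alpha> umax vmax wmax Smax N0 D0 S0 u' v' w' \<longrightarrow>
        payoff T p r A K B \<alpha> N0 D0 S0 u' v' w' \<le> payoff T p r A K B \<alpha> N0 D0 S0 u v w)"

lemma linear_ode_unique:
  fixes x y g :: "real \<Rightarrow> real" and c :: real
  assumes "finite F" "finite G"
    and cont: "continuous_on {0..T} x" "continuous_on {0..T} y"
    and init: "x 0 = y 0"
    and dx: "\<And>t. t \<in> {0..T} - F \<Longrightarrow> (x has_real_derivative (c * x t + g t)) (at t within {0..T})"
    and dy: "\<And>t. t \<in> {0..T} - G \<Longrightarrow> (y has_real_derivative (c * y t + g t)) (at t within {0..T})"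
    and t: "t \<in> {0..T}"
  shows "x t = y t"
proof -
  have "exp (- c * t) * (x t - y t) = 0"
  proof (rule has_derivative_zero_unique_strong_interval
      [where k = "F \<union> G" and f = "\<lambda>t. exp (- c * t) * (x t - y t)"])
    show "finite (F \<union> G)" using assms by simp
    show "continuous_on {0..T} (\<lambda>t. exp (- c * t) * (x t - y t))"
      by (intro continuous_intros cont)
    show "exp (- c * 0) * (x 0 - y 0) = 0" using init by simp
    show "t \<in> {0..T}" by (rule t)
    fix s assume s: "s \<in> {0..T} - (F \<union> G)"
    have "((\<lambda>t. exp (- c * t) * (x t - y t)) has_real_derivative 0) (at s within {0..T})"
      using s by (auto intro!: derivative_eq_intros dx dy simp: algebra_simps)
    then show "((\<lambda>t. exp (- c * t) * (x t - y t)) has_derivative (\<lambda>h. 0)) (at s within {0..T})"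
      by (simp add: has_field_derivative_def lambda_zero)
  qed
  then show ?thesis by simp
qed

lemma trajectory_unique:
  assumes 1: "trajectory T p r A K B \<alpha> N0 D0 S0 u v w N D S"
    and 2: "trajectory T p r A K B \<alpha> N0 D0 S0 u v w N' D' S'"
    and t: "t \<in> {0..T}"
  shows "N t = N' t" "D t = D' t" "S t = S' t"
proof -
  obtain F where F: "finite F" "\<And>t. t \<in> {0..T} - F \<Longrightarrow>
        (N has_real_derivative (p * w t - v t - K * u t - B)) (at t within {0..T}) \<and>
        (D has_real_derivative (r * D t + A * u t - v t)) (at t within {0..T}) \<and>
        (S has_real_derivative (u t - w t - \<alpha> * S t)) (at t within {0..T})"
    using 1 unfolding trajectory_def by blast
  obtain G where G: "finite G" "\<And>t. t \<in> {0..T} - G \<Longrightarrow>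
        (N' has_real_derivative (p * w t - v t - K * u t - B)) (at t within {0..T}) \<and>
        (D' has_real_derivative (r * D' t + A * u t - v t)) (at t within {0..T}) \<and>
        (S' has_real_derivative (u t - w t - \<alpha> * S' t)) (at t within {0..T})"
    using 2 unfolding trajectory_def by blast
  note c = 1[unfolded trajectory_def] 2[unfolded trajectory_def]
  show "N t = N' t"
    by (rule linear_ode_unique[OF F(1) G(1), where c = 0 and
          g = "\<lambda>t. p * w t - v t - K * u t - B"]) (use c F(2) G(2) t in auto)
  show "D t = D' t"
    by (rule linear_ode_unique[OF F(1) G(1), where c = r and
          g = "\<lambda>t. A * u t - v t"]) (use c F(2) G(2) t in \<open>auto simp: algebra_simps\<close>)
  show "S t = S' t"
    by (rule linear_ode_unique[OF F(1) G(1), where c = "- \<alpha>" and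
          g = "\<lambda>t. u t - w t"]) (use c F(2) G(2) t in \<open>auto simp: algebra_simps\<close>)
qed

lemma payoff_eq:
  assumes "0 \<le> T" and tr: "trajectory T p r A K B \<alpha> N0 D0 S0 u v w N D S"
  shows "payoff T p r A K B \<alpha> N0 D0 S0 u v w = N T - D T"
  unfolding payoff_def
proof (rule the_equality)
  show "\<exists>N' D' S'. trajectory T p r A K B \<alpha> N0 D0 S0 u v w N' D' S' \<and> N T - D T = N' T - D' T"
    using tr by blast
  have T: "T \<in> {0..T}" using assms by simp
  fix J assume "\<exists>N D S. trajectory T p r A K B \<alpha> N0 D0 S0 u v w N D S \<and> J = N T - D T"
  then show "J = N T - D T"
    using trajectory_unique(1,2)[OF _ tr T] by metis
qed

end

theory Submission
  imports Defs
begin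

text \<open>
  Along any trajectory, \<open>E = N - D + (A + K) S\<close> satisfies
  \<open>E' = (p - A - K) w - B - r D - (A + K) \<alpha> S\<close>: the controls \<open>u\<close> and \<open>v\<close> cancel.
  For an admissible control, \<open>w \<le> w\<^sub>m\<^sub>a\<^sub>x\<close>, \<open>D \<ge> 0\<close>, and \<open>S\<close> is at least the stock that is sold at the
  maximal rate without purchases until it is empty.  The proposed control attains equality in all
  three bounds and ends with \<open>S(T) = 0\<close>, so it maximises \<open>N(T) - D(T) = E(T) - (A + K) S(T)\<close>.
\<close>

section \<open>Comparison for linear differential equations, and derivatives of positive
  parts\<close>

text \<open>The integrating factor \<open>exp (- c * t)\<close> removes the linear term: the
  weighted difference has derivative \<open>exp (- c * t) * (h t - g t)\<close>, which is
  nonnegative off \<open>F\<close>. Integrating this, rather than arguing pointwise, makes the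
  finitely many jump times of the controls harmless.\<close>

lemma linear_ode_mono:
  fixes x y g h :: "real \<Rightarrow> real" and c :: real
  assumes "finite F" "0 \<le> T"
    and cont: "continuous_on {0..T} x" "continuous_on {0..T} y"
    and init: "x 0 \<le> y 0"
    and dx: "\<And>t. t \<in> {0..T} - F \<Longrightarrow> (x has_real_derivative (c * x t + g t)) (at t within {0..T})"
    and dy: "\<And>t. t \<in> {0..T} - F \<Longrightarrow> (y has_real_derivative (c * y t + h t)) (at t within {0..T})"
    and le: "\<And>t. t \<in> {0..T} - F \<Longrightarrow> g t \<le> h t"
  shows "x T \<le> y T"
proof -
  define q where "q t = exp (- c * t) * (y t - x t)" for t
  \<comment> \<open>The value 0 on \<open>F\<close> is a default that keeps \<open>q'\<close>
    nonnegative on the whole interval, where its integral is estimated.\<close>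
  define q' where "q' t = (if t \<in> F then 0 else exp (- c * t) * (h t - g t))" for t
  have "(q has_vector_derivative q' t) (at t)" if "t \<in> {0<..<T} - F" for t
  proof -
    have t: "t \<in> {0..T} - F" "t \<in> interior {0..T}"
      using that by auto
    have "(q has_real_derivative q' t) (at t within {0..T})"
      unfolding q_def using t(1)
      by (auto intro!: derivative_eq_intros dx dy simp: q'_def algebra_simps)
    then show ?thesis
      using t(2) by (metis at_within_interior has_real_derivative_iff_has_vector_derivative)
  qed
  moreover have "continuous_on {0..T} q"
    unfolding q_def by (intro continuous_intros cont)
  ultimately have "(q' has_integral (q T - q 0)) {0..T}"
    using assms(1,2) by (intro fundamental_theorem_of_calculus_interior_strong) auto
  then have "0 \<le> q T - q 0"
    by (rule has_integral_nonneg) (use le in \<open>auto simp: q'_def\<close>)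
  moreover have "0 \<le> q 0"
    using init by (simp add: q_def)
  ultimately have "0 \<le> exp (- c * T) * (y T - x T)"
    by (simp add: q_def)
  then show ?thesis
    by (simp add: zero_le_mult_iff)
qed

text \<open>By continuity \<open>f\<close> keeps its sign near \<open>t\<close>, so the positive
  part agrees locally with \<open>f\<close> or with 0; the hypothesis \<open>f t \<noteq> 0\<close>
  excludes the kink. It differentiates both the cash and the stock of the proposed strategy away
  from \<open>tS\<close>.\<close>

lemma has_real_derivative_max_0:
  fixes f :: "real \<Rightarrow> real"
  assumes f: "(f has_real_derivative d) (at t)" and "f t \<noteq> 0"
  shows "((\<lambda>s. max 0 (f s)) has_real_derivative (if 0 < f t then d else 0)) (at t within X)"
proof -
  have lim: "(f \<longlongrightarrow> f t) (nhds t)"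
    using DERIV_isCont[OF f] by (simp add: isCont_def tendsto_at_iff_tendsto_nhds)
  have "((\<lambda>s. max 0 (f s)) has_real_derivative (if 0 < f t then d else 0)) (at t)"
  proof (cases "0 < f t")
    case True
    then have "\<forall>\<^sub>F s in nhds t. max 0 (f s) = f s"
      using order_tendstoD(1)[OF lim True] by (auto elim!: eventually_mono)
    then have "((\<lambda>s. max 0 (f s)) has_real_derivative d) (at t) \<longleftrightarrow>
      (f has_real_derivative d) (at t)"
      by (intro DERIV_cong_ev) auto
    then show ?thesis
      using f True by simp
  next
    case False
    then have "f t < 0"
      using assms(2) by simp
    then have "\<forall>\<^sub>F s in nhds t. max 0 (f s) = 0"
      using order_tendstoD(2)[OF lim \<open>f t < 0\<close>] by (auto elim!: eventually_mono)
    then have "((\<lambda>s. max 0 (f s)) has_real_derivative 0) (at t) \<longleftrightarrow>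
      ((\<lambda>s. 0) has_real_derivative 0) (at t)"
      by (intro DERIV_cong_ev) auto
    then show ?thesis
      using False by simp
  qed
  then show ?thesis
    by (rule has_field_derivative_at_within)
qed

section \<open>Piecewise continuity of the proposed controls\<close>

lemma piecewise_continuous_on_step:
  "piecewise_continuous_on a b (\<lambda>t. if t < c then x else y)"
  unfolding piecewise_continuous_on_def
proof (intro conjI ballI exI)
  let ?f = "\<lambda>t. if t < c then x else y"
  show "finite {c}"
    by simp
  have "continuous_on ({..<c} \<union> {c<..}) ?f"
    by (rule continuous_on_open_Un) (auto intro: continuous_on_eq[OF continuous_on_const])
  then show "continuous_on ({a..b} - {c}) ?f"
    by (rule continuous_on_subset) auto
  show "(?f \<longlongrightarrow> (if t < c then x else y)) (at_right t)" for t
  proof (rule tendsto_eventually)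
    show "\<forall>\<^sub>F s in at_right t. ?f s = (if t < c then x else y)"
      by (cases "t < c")
        (auto simp: eventually_at_right_field intro: exI[of _ c] exI[of _ "t + 1"])
  qed
  \<comment> \<open>At \<open>c\<close> the left limit is still \<open>x\<close> although the value
    there is \<open>y\<close>, hence \<open>\<le>\<close> in place of \<open><\<close>.\<close>
  show "(?f \<longlongrightarrow> (if t \<le> c then x else y)) (at_left t)" for t
  proof (rule tendsto_eventually)
    show "\<forall>\<^sub>F s in at_left t. ?f s = (if t \<le> c then x else y)"
      by (cases "t \<le> c")
        (auto simp: eventually_at_left_field intro: exI[of _ c] exI[of _ "t - 1"])
  qed
qed

lemma piecewise_continuous_on_const: "piecewise_continuous_on a b (\<lambda>t. x)"
  using piecewise_continuous_on_step[of a b 0 x x] by simp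

section \<open>The stock under pure sale and the proposed trajectory\<close>

text \<open>This is the solution of the stock equation for \<open>u = 0\<close> and
  \<open>w = wmax\<close> with the state constraint ignored. It becomes negative once the stock is
  exhausted, so the actual stock is its positive part.\<close>

definition pure_sale_stock :: "real \<Rightarrow> real \<Rightarrow> real \<Rightarrow> real \<Rightarrow> real" where
  "pure_sale_stock \<alpha> wmax S0 t = (S0 + wmax / \<alpha>) * exp (- \<alpha> * t) - wmax / \<alpha>"

lemma pure_sale_stock_0 [simp]: "pure_sale_stock \<alpha> wmax S0 0 = S0"
  by (simp add: pure_sale_stock_def)

lemma pure_sale_stock_continuous [continuous_intros]:
  "continuous_on X (pure_sale_stock \<alpha> wmax S0)"
  unfolding pure_sale_stock_def by (intro continuous_intros)

lemma pure_sale_stock_deriv: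
  assumes "\<alpha> \<noteq> 0"
  shows "(pure_sale_stock \<alpha> wmax S0 has_real_derivative
           (- wmax - \<alpha> * pure_sale_stock \<alpha> wmax S0 t)) (at t within X)"
  unfolding pure_sale_stock_def
  by (rule derivative_eq_intros refl)+ (use assms in \<open>simp add: field_simps\<close>)

text \<open>Solving for the zero gives \<open>tS\<close>; the function is then a positive multiple
  of \<open>exp (- \<alpha> * t) - exp (- \<alpha> * tS)\<close>, whose sign follows from strict
  monotonicity of \<open>exp\<close>.\<close>

lemma pure_sale_stock_sgn:
  assumes "\<alpha> > 0" "wmax > 0" "S0 > 0"
    and tS: "tS = 1 / \<alpha> * ln ((\<alpha> * S0 + wmax) / wmax)"
  shows "tS > 0" "pure_sale_stock \<alpha> wmax S0 t = 0 \<longleftrightarrow> t = tS"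
    "0 < pure_sale_stock \<alpha> wmax S0 t \<longleftrightarrow> t < tS"
proof -
  have "(\<alpha> * S0 + wmax) / wmax > 1"
    using assms by simp
  then show "tS > 0"
    unfolding tS using \<open>\<alpha> > 0\<close> by (intro mult_pos_pos ln_gt_zero) auto
  have "exp (\<alpha> * tS) = (\<alpha> * S0 + wmax) / wmax"
    using assms by (simp add: add_pos_pos)
  then have "S0 + wmax / \<alpha> = wmax / \<alpha> * exp (\<alpha> * tS)"
    using assms(1,2) by (simp add: field_simps)
  then have e: "wmax / \<alpha> = (S0 + wmax / \<alpha>) * exp (- \<alpha> * tS)"
    by (simp add: exp_minus)
  have pos: "0 < S0 + wmax / \<alpha>"
    using assms by (simp add: add_pos_pos)
  have "pure_sale_stock \<alpha> wmax S0 t = (S0 + wmax / \<alpha>) * (exp (- \<alpha> * t) - exp (- \<alpha> * tS))"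
    using e by (simp add: pure_sale_stock_def right_diff_distrib)
  then show "pure_sale_stock \<alpha> wmax S0 t = 0 \<longleftrightarrow> t = tS"
    "0 < pure_sale_stock \<alpha> wmax S0 t \<longleftrightarrow> t < tS"
    using pos \<open>\<alpha> > 0\<close> by (auto simp: zero_less_mult_iff)
qed

text \<open>From \<open>tS\<close> on, purchases match sales, so the stock stays empty, and the
  repayment \<open>A * wmax\<close> cancels the new debt, so \<open>D\<close> stays 0. Cash then
  grows more slowly by \<open>(A + K) * wmax\<close>. The positive parts merge both phases into
  single formulas, with \<open>tS\<close> as the only exceptional time.\<close>

lemma trajectory_sell_then_balance:
  assumes "\<alpha> > 0" "wmax > 0" "S0 > 0"
    and tS: "tS = 1 / \<alpha> * ln ((\<alpha> * S0 + wmax) / wmax)"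
  shows "trajectory T p r A K B \<alpha> N0 0 S0
    (\<lambda>t. if t < tS then 0 else wmax) (\<lambda>t. if t < tS then 0 else A * wmax) (\<lambda>t. wmax)
    (\<lambda>t. N0 + (p * wmax - B) * t - (A + K) * wmax * max 0 (t - tS)) (\<lambda>t. 0)
    (\<lambda>t. max 0 (pure_sale_stock \<alpha> wmax S0 t))"
    (is "trajectory T p r A K B \<alpha> N0 0 S0 ?u ?v ?w ?N ?D ?S")
proof -
  note sgn = pure_sale_stock_sgn[OF assms]
  show ?thesis
    unfolding trajectory_def
  proof (intro conjI exI[of _ "{tS}"] ballI)
    show "continuous_on {0..T} ?N" "continuous_on {0..T} ?D" "continuous_on {0..T} ?S"
      by (intro continuous_intros)+
    show "?N 0 = N0" "?D 0 = 0" "?S 0 = S0" "finite {tS}"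
      using sgn(1) assms(3) by simp_all
    fix t assume that: "t \<in> {0..T} - {tS}"
    have ne: "t \<noteq> tS"
      using that by simp
    have "((\<lambda>s. max 0 (s - tS)) has_real_derivative (if 0 < t - tS then 1 else 0))
        (at t within {0..T})"
      by (rule has_real_derivative_max_0) (use ne in \<open>auto intro!: derivative_eq_intros\<close>)
    note [derivative_intros] = this
    show "(?N has_real_derivative (p * ?w t - ?v t - K * ?u t - B)) (at t within {0..T})"
      by (rule derivative_eq_intros refl)+ (use ne in \<open>auto simp: algebra_simps\<close>)
    show "(?D has_real_derivative (r * ?D t + A * ?u t - ?v t)) (at t within {0..T})"
      by simp
    have "pure_sale_stock \<alpha> wmax S0 t \<noteq> 0"
      using ne sgn(2) by simp
    from has_real_derivative_max_0[OF pure_sale_stock_deriv this, of "{0..T}"] assms(1)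
    have "(?S has_real_derivative (if 0 < pure_sale_stock \<alpha> wmax S0 t
        then - wmax - \<alpha> * pure_sale_stock \<alpha> wmax S0 t else 0)) (at t within {0..T})"
      by simp
    \<comment> \<open>Before \<open>tS\<close> the pure sale stock is positive and \<open>u\<close>
      is 0; afterwards the truncated stock vanishes and \<open>u\<close> equals
      \<open>w\<close>.\<close>
    then show "(?S has_real_derivative (?u t - ?w t - \<alpha> * ?S t)) (at t within {0..T})"
      by (rule DERIV_cong) (use sgn(3)[of t] in \<open>auto simp: max_def\<close>)
  qed
qed

section \<open>Bounds for competing trajectories\<close>

text \<open>The inflow \<open>u - w\<close> is never below \<open>- wmax\<close>, so the comparison
  principle applies with equal initial stocks.\<close>

lemma stock_ge_pure_sale_stock:
  assumes tr: "trajectory T p r A K B \<alpha> N0 D0 S0 u v w N D S"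
    and "\<alpha> \<noteq> 0" and uw: "\<And>t. t \<in> {0..T} \<Longrightarrow> 0 \<le> u t \<and> w t \<le> wmax"
    and t: "t \<in> {0..T}"
  shows "pure_sale_stock \<alpha> wmax S0 t \<le> S t"
proof -
  obtain F where F: "finite F" "\<And>s. s \<in> {0..T} - F \<Longrightarrow>
        (S has_real_derivative (u s - w s - \<alpha> * S s)) (at s within {0..T})"
    and S: "continuous_on {0..T} S" "S 0 = S0"
    using tr unfolding trajectory_def by blast
  show ?thesis
  \<comment> \<open>The comparison principle speaks only about the right endpoint, so it is applied
    on \<open>{0..t}\<close>.\<close>
  proof (rule linear_ode_mono[OF F(1), where T = t and x = "pure_sale_stock \<alpha> wmax S0" and y = S
        and c = "- \<alpha>" and g = "\<lambda>s. - wmax"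
        and h = "\<lambda>s. u s - w s"])
    show "continuous_on {0..t} S"
      using S(1) t by (auto intro: continuous_on_subset)
    show "continuous_on {0..t} (pure_sale_stock \<alpha> wmax S0)"
      by (intro continuous_intros)
    fix s assume s: "s \<in> {0..t} - F"
    show "(pure_sale_stock \<alpha> wmax S0 has_real_derivative
        - \<alpha> * pure_sale_stock \<alpha> wmax S0 s + - wmax) (at s within {0..t})"
      by (rule DERIV_cong[OF pure_sale_stock_deriv]) (use assms(2) in auto)
    have "(S has_real_derivative (u s - w s - \<alpha> * S s)) (at s within {0..t})"
      by (rule has_field_derivative_subset[OF F(2)]) (use s t in auto)
    then show "(S has_real_derivative (- \<alpha> * S s + (u s - w s))) (at s within {0..t})"
      by (rule DERIV_cong) simp
    show "- wmax \<le> u s - w s"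
      using uw[of s] s t by auto
  qed (use S t in auto)
qed

text \<open>Valuing the stock at \<open>A + K\<close> per unit, its full purchase cost, cancels
  \<open>u\<close>, while \<open>v\<close> moves cash and debt equally. The remaining rate increases
  with \<open>w\<close> and decreases with \<open>D\<close> and \<open>S\<close>, by the sign
  hypotheses.\<close>

lemma trajectory_net_worth_le:
  assumes tr: "trajectory T p r A K B \<alpha> N0 D0 S0 u v w N D S"
    and tr': "trajectory T p r A K B \<alpha> N0 D0 S0 u' v' w' N' D' S'"
    and pos: "0 \<le> T" "0 \<le> r" "0 \<le> \<alpha>" "0 \<le> A + K" "0 \<le> p - A - K"
    and le: "\<And>t. t \<in> {0..T} \<Longrightarrow> w' t \<le> w t \<and> D t \<le> D' t \<and> S t \<le> S' t"
  shows "N' T - D' T + (A + K) * S' T \<le> N T - D T + (A + K) * S T"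
proof -
  obtain F where F: "finite F" "\<And>t. t \<in> {0..T} - F \<Longrightarrow>
        (N has_real_derivative (p * w t - v t - K * u t - B)) (at t within {0..T}) \<and>
        (D has_real_derivative (r * D t + A * u t - v t)) (at t within {0..T}) \<and>
        (S has_real_derivative (u t - w t - \<alpha> * S t)) (at t within {0..T})"
    using tr unfolding trajectory_def by blast
  obtain G where G: "finite G" "\<And>t. t \<in> {0..T} - G \<Longrightarrow>
        (N' has_real_derivative (p * w' t - v' t - K * u' t - B)) (at t within {0..T}) \<and>
        (D' has_real_derivative (r * D' t + A * u' t - v' t)) (at t within {0..T}) \<and>
        (S' has_real_derivative (u' t - w' t - \<alpha> * S' t)) (at t within {0..T})"
    using tr' unfolding trajectory_def by blast
  note c = tr[unfolded trajectory_def] tr'[unfolded trajectory_def]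
  let ?e = "\<lambda>w D S t. (p - A - K) * w t - B - r * D t - (A + K) * \<alpha> * S t"
  show ?thesis
  \<comment> \<open>With \<open>c = 0\<close> the comparison reduces to comparing the rates
    themselves.\<close>
  proof (rule linear_ode_mono[where c = 0 and F = "F \<union> G" and T = T
        and g = "?e w' D' S'" and h = "?e w D S"
        and x = "\<lambda>t. N' t - D' t + (A + K) * S' t" and y = "\<lambda>t. N t - D t + (A + K) * S t"])
    show "continuous_on {0..T} (\<lambda>t. N' t - D' t + (A + K) * S' t)"
      "continuous_on {0..T} (\<lambda>t. N t - D t + (A + K) * S t)"
      using c by (auto intro!: continuous_intros)
    fix t assume t: "t \<in> {0..T} - (F \<union> G)"
    show "((\<lambda>t. N t - D t + (A + K) * S t) has_real_derivative
        0 * (N t - D t + (A + K) * S t) + ?e w D S t) (at t within {0..T})"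
      using F(2)[of t] t by (auto intro!: derivative_eq_intros simp: algebra_simps)
    show "((\<lambda>t. N' t - D' t + (A + K) * S' t) has_real_derivative
        0 * (N' t - D' t + (A + K) * S' t) + ?e w' D' S' t) (at t within {0..T})"
      using G(2)[of t] t by (auto intro!: derivative_eq_intros simp: algebra_simps)
    have "(p - A - K) * w' t \<le> (p - A - K) * w t" "r * D t \<le> r * D' t"
      "(A + K) * \<alpha> * S t \<le> (A + K) * \<alpha> * S' t"
      using le[of t] t pos by (auto intro!: mult_left_mono)
    then show "?e w' D' S' t \<le> ?e w D S t"
      by linarith
  qed (use F(1) G(1) pos c in auto)
qed

theorem mainTheorem1:
  fixes T p r A K B \<alpha> umax vmax wmax Smax N0 D0 S0 tS :: real
    and u v w :: "real \<Rightarrow> real"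
  assumes "T > 0" "p > 0" "r > 0" "A > 0" "K > 0" "B > 0" "\<alpha> > 0"
    and "umax > 0" "vmax > 0" "wmax > 0" "Smax > 0"
    and "wmax \<le> umax" "vmax \<ge> A * wmax" "(p - A - K) * wmax > B"
    and "N0 > 0" "D0 = 0" "0 < S0" "S0 \<le> Smax"
    and "tS = 1 / \<alpha> * ln ((\<alpha> * S0 + wmax) / wmax)" "tS < T"
    and "u = (\<lambda>t. if t < tS then 0 else wmax)"
    and "v = (\<lambda>t. if t < tS then 0 else A * wmax)"
    and "w = (\<lambda>t. wmax)"
  shows "optimal_control T p r A K B \<alpha> umax vmax wmax Smax N0 D0 S0 u v w
    \<and> (\<forall>N D S. trajectory T p r A K B \<alpha> N0 D0 S0 u v w N D S
          \<longrightarrow> (\<forall>t\<in>{0..<tS}. S t > 0) \<and> S tS = 0)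
    \<and> payoff T p r A K B \<alpha> N0 D0 S0 u v w
        = N0 + (p * wmax - B) * T + (A + K) * wmax * (tS - T)"
proof -
  define N where "N t = N0 + (p * wmax - B) * t - (A + K) * wmax * max 0 (t - tS)" for t
  define S where "S t = max 0 (pure_sale_stock \<alpha> wmax S0 t)" for t
  note sgn = pure_sale_stock_sgn[OF \<open>\<alpha> > 0\<close> \<open>wmax > 0\<close> \<open>0 < S0\<close>
      \<open>tS = 1 / \<alpha> * ln ((\<alpha> * S0 + wmax) / wmax)\<close>]
  have tr: "trajectory T p r A K B \<alpha> N0 D0 S0 u v w N (\<lambda>t. 0) S"
    unfolding N_def S_def \<open>u = _\<close> \<open>v = _\<close> \<open>w = _\<close> \<open>D0 = 0\<close>
    using trajectory_sell_then_balance assms by blast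
  have pay: "payoff T p r A K B \<alpha> N0 D0 S0 u v w = N T"
    using payoff_eq[OF _ tr] \<open>T > 0\<close> by simp
  have ST: "S T = 0"
    using sgn(3)[of T] \<open>tS < T\<close> by (simp add: S_def max_def not_less)
  have profit: "0 < p - A - K"
    using \<open>(p - A - K) * wmax > B\<close> \<open>B > 0\<close> \<open>wmax > 0\<close>
    by (smt (verit) mult_nonpos_nonneg)
  \<comment> \<open>Because \<open>tS > 0\<close>, the positive part of \<open>t - tS\<close> is at
    most \<open>t\<close>; hence \<open>N t\<close> is at least
    \<open>N0 + ((p - A - K) * wmax - B) * t\<close>, which profitability makes nonnegative.\<close>
  have "0 \<le> N t" if "t \<in> {0..T}" for t
  proof -
    have "(A + K) * wmax * max 0 (t - tS) \<le> (A + K) * wmax * t"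
      using that sgn(1) \<open>A > 0\<close> \<open>K > 0\<close> \<open>wmax > 0\<close> by (intro mult_left_mono) auto
    moreover have "0 \<le> ((p - A - K) * wmax - B) * t"
      using that \<open>(p - A - K) * wmax > B\<close> by simp
    ultimately show ?thesis
      using \<open>N0 > 0\<close> by (simp add: N_def algebra_simps)
  qed
  moreover have "S t \<le> Smax" if "t \<in> {0..T}" for t
  proof -
    have "(S0 + wmax / \<alpha>) * exp (- \<alpha> * t) \<le> (S0 + wmax / \<alpha>) * 1"
      using that \<open>0 < S0\<close> \<open>wmax > 0\<close> \<open>\<alpha> > 0\<close> by (intro mult_left_mono) auto
    then show ?thesis
      using \<open>S0 \<le> Smax\<close> \<open>Smax > 0\<close> by (simp add: S_def pure_sale_stock_def)
  qed
  moreover have "piecewise_continuous_on 0 T u" "piecewise_continuous_on 0 T v"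
    "piecewise_continuous_on 0 T w"
    unfolding \<open>u = _\<close> \<open>v = _\<close> \<open>w = _\<close>
    by (rule piecewise_continuous_on_step piecewise_continuous_on_const)+
  moreover have "0 \<le> S t" for t
    by (simp add: S_def)
  moreover have "0 \<le> u t \<and> u t \<le> umax \<and> 0 \<le> v t \<and> v t \<le> vmax \<and> 0 \<le> w t \<and> w t \<le> wmax" for t
    using \<open>umax > 0\<close> \<open>vmax > 0\<close> \<open>wmax > 0\<close> \<open>A > 0\<close> \<open>wmax \<le> umax\<close> \<open>vmax \<ge> A * wmax\<close>
    by (auto simp: \<open>u = _\<close> \<open>v = _\<close> \<open>w = _\<close>)
  ultimately have adm:
    "admissible_control T p r A K B \<alpha> umax vmax wmax Smax N0 D0 S0 u v w"
    unfolding admissible_control_def using tr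
    by (intro conjI ballI exI[of _ N] exI[of _ "\<lambda>t. 0"] exI[of _ S]) auto
  have "payoff T p r A K B \<alpha> N0 D0 S0 u' v' w' \<le> N T"
    if adm': "admissible_control T p r A K B \<alpha> umax vmax wmax Smax N0 D0 S0 u' v' w'" for u' v' w'
  proof -
    obtain N' D' S' where tr': "trajectory T p r A K B \<alpha> N0 D0 S0 u' v' w' N' D' S'"
      and state: "\<And>t. t \<in> {0..T} \<Longrightarrow> 0 \<le> D' t \<and> 0 \<le> S' t"
      and ctrl: "\<And>t. t \<in> {0..T} \<Longrightarrow> 0 \<le> u' t \<and> w' t \<le> wmax"
      using adm' unfolding admissible_control_def by blast
    \<comment> \<open>Both arguments of the maximum lie below \<open>S' t\<close>: the pure sale
      stock by comparison, and 0 by the state constraint.\<close>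
    have "S t \<le> S' t" if "t \<in> {0..T}" for t
      using stock_ge_pure_sale_stock[OF tr' _ ctrl that] state[OF that] \<open>\<alpha> > 0\<close>
      by (simp add: S_def)
    then have "N' T - D' T + (A + K) * S' T \<le> N T - 0 + (A + K) * S T"
      using trajectory_net_worth_le[OF tr tr'] state ctrl profit
        \<open>T > 0\<close> \<open>r > 0\<close> \<open>\<alpha> > 0\<close> \<open>A > 0\<close> \<open>K > 0\<close>
      by (simp add: \<open>w = _\<close>)
    \<comment> \<open>A competitor's leftover stock is worthless in the payoff, while the proposed
      strategy ends with none; dropping this term leaves the payoff inequality.\<close>
    moreover have "0 \<le> (A + K) * S' T"
      using state[of T] \<open>T > 0\<close> \<open>A > 0\<close> \<open>K > 0\<close> by simp
    ultimately show ?thesis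
      using payoff_eq[OF _ tr'] ST \<open>T > 0\<close> by simp
  qed
  with adm have "optimal_control T p r A K B \<alpha> umax vmax wmax Smax N0 D0 S0 u v w"
    by (simp add: optimal_control_def pay)
  \<comment> \<open>Uniqueness of trajectories on \<open>{0..T}\<close>, which contains
    \<open>tS\<close>, carries the signs of the explicit \<open>S\<close> over to any trajectory of
    the control.\<close>
  moreover have "(\<forall>t\<in>{0..<tS}. S' t > 0) \<and> S' tS = 0"
    if "trajectory T p r A K B \<alpha> N0 D0 S0 u v w N' D' S'" for N' D' S'
  proof -
    have "S' t = S t" if "t \<in> {0..tS}" for t
      using trajectory_unique(3)[OF \<open>trajectory T p r A K B \<alpha> N0 D0 S0 u v w N' D' S'\<close> tr, of t]
        that \<open>tS < T\<close> by simp
    then show ?thesis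
      using sgn(1,3) sgn(2)[of tS] by (auto simp: S_def)
  qed
  moreover have "N T = N0 + (p * wmax - B) * T + (A + K) * wmax * (tS - T)"
    using \<open>tS < T\<close> by (simp add: N_def algebra_simps)
  ultimately show ?thesis
    unfolding pay by blast
qed

end
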